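(* Let $k\ge1$, $g\ge1$, $n\ge1$, $r\ge1$ be integers, $p\in(0,1)$, $q=1-p$, and put $\nu=n-(r-1)(g-1)$. Let $N_s$ be the number of success runs (of order $k$ with gap $g$) in $n$ independent Bernoulli trials with success probability $p$, and let $F_n^{(r)}=\mathbb{E}[N_s(N_s-1)\cdots(N_s-r+1)]$ be its $r$-th factorial moment. Then $$F_n^{(r)}=r!\sum_{m=r}^{\left\lfloor\frac{\nu+1}{k+1}\right\rfloor}(-1)^{m-r}q^{m-1}p^{mk}\binom{m-1}{r-1}\sum_{s=0}^{m-r}(-1)^s\binom{m-r}{s}\left[\binom{\nu+1-mk-s(g-1)}{m}-p\binom{\nu-mk-s(g-1)}{m}\right].$$
   Context: Convention: $\binom{a}{b}=0$ whenever $a<b$ (including negative $a$), and a sum whose upper limit is smaller than its lower limit is zero. Consider a sequence of $n$ independent trials, each $S$ (success) with probability $p$ or $F$ (failure) with probability $q=1-p$. The success runs (of order $k$ with gap $g$) are defined inductively. The first success run (if it exists) is the first run of at least $k$ consecutive successes, taken maximal (it cannot be extended to a longer run). A success run terminates at trial $m$ if trial $m$ is its last success, i.e. either $m=n$ or trial $m+1$ is a failure. If the $j$-th success run terminates at trial $m$, then the $(j+1)$-th success run (if it exists) is the first run of at least $k$ consecutive successes which begins later than trial $m+g$, taken maximal among runs beginning later than trial $m+g$ (trials $m+1,\dots,m+g$ form the gap: an $F$ followed by $g-1$ arbitrary outcomes). *)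

theory Defs
  imports "HOL-Probability.Probability"
begin

text \<open>The outcomes of the trials \<open>1, \<dots>, n\<close> are given by \<open>x :: nat \<Rightarrow> bool\<close>, where \<open>True\<close> is a
  success; the values of \<open>x\<close> outside \<open>{1..n}\<close> are never looked at. A run of consecutive
  successes is represented by its first trial \<open>a\<close> and its last trial \<open>b\<close>.\<close>

definition run_beyond :: "nat \<Rightarrow> (nat \<Rightarrow> bool) \<Rightarrow> nat \<Rightarrow> nat \<Rightarrow> nat \<Rightarrow> bool" where
  "run_beyond n x c a b \<longleftrightarrow> c < a \<and> a \<le> b \<and> b \<le> n \<and> (\<forall>i\<in>{a..b}. x i)"

text \<open>Maximality is only among the runs beginning later than \<open>c\<close>, so a maximal run that begins
  at \<open>c + 1\<close> may be preceded by a success at trial \<open>c\<close>.\<close>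

definition maximal_run_beyond :: "nat \<Rightarrow> (nat \<Rightarrow> bool) \<Rightarrow> nat \<Rightarrow> nat \<Rightarrow> nat \<Rightarrow> bool" where
  "maximal_run_beyond n x c a b \<longleftrightarrow> run_beyond n x c a b \<and>
     (\<forall>a' b'. run_beyond n x c a' b' \<and> a' \<le> a \<and> b \<le> b' \<longrightarrow> a' = a \<and> b' = b)"

definition first_run_beyond :: "nat \<Rightarrow> nat \<Rightarrow> (nat \<Rightarrow> bool) \<Rightarrow> nat \<Rightarrow> nat \<Rightarrow> nat \<Rightarrow> bool" where
  "first_run_beyond k n x c a b \<longleftrightarrow>
     maximal_run_beyond n x c a b \<and> k \<le> b + 1 - a \<and>
     (\<forall>a' b'. maximal_run_beyond n x c a' b' \<and> k \<le> b' + 1 - a' \<longrightarrow> a \<le> a')"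

text \<open>\<open>success_run k g n x j a b\<close>: the \<open>j\<close>-th success run exists and occupies the trials
  \<open>a, \<dots>, b\<close>.\<close>

inductive success_run ::
    "nat \<Rightarrow> nat \<Rightarrow> nat \<Rightarrow> (nat \<Rightarrow> bool) \<Rightarrow> nat \<Rightarrow> nat \<Rightarrow> nat \<Rightarrow> bool"
  for k g n :: nat and x :: "nat \<Rightarrow> bool" where
  first_run: "first_run_beyond k n x 0 a b \<Longrightarrow> success_run k g n x 1 a b"
| later_run: "success_run k g n x j l m \<Longrightarrow> first_run_beyond k n x (m + g) a b
    \<Longrightarrow> success_run k g n x (Suc j) a b"

definition num_success_runs :: "nat \<Rightarrow> nat \<Rightarrow> nat \<Rightarrow> (nat \<Rightarrow> bool) \<Rightarrow> nat" where
  "num_success_runs k g n x = card {j. \<exists>a b. success_run k g n x j a b}"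

text \<open>The set counted in \<open>num_success_runs\<close> is finite, so its cardinality is not a
  default value.\<close>

lemma finite_success_runs: "finite {j. \<exists>a b. success_run k g n x j a b}"
proof -
  have "j \<le> b \<and> b \<le> n" if "success_run k g n x j a b" for j a b
    using that
    by induction (auto simp: first_run_beyond_def maximal_run_beyond_def run_beyond_def)
  then have "{j. \<exists>a b. success_run k g n x j a b} \<subseteq> {..n}"
    by fastforce
  then show ?thesis
    using finite_subset by blast
qed

text \<open>Binomial coefficient with an integer upper entry that vanishes below the lower entry, in
  particular for negative upper entries (unlike \<open>gchoose\<close>).\<close>

definition binom :: "int \<Rightarrow> nat \<Rightarrow> nat" where
  "binom a b = (if a < int b then 0 else nat a choose b)"

end

theory Submission
  imports Defs
begin

text \<open>
  Since \<open>N (N - 1) \<cdots> (N - r + 1) = r! (N choose r)\<close>, it suffices to know the generating function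
  \<open>B\<^sub>r(z)\<close> of the binomial moments \<open>E (N\<^sub>n choose r)\<close>. Condition on the first failure: after
  \<open>i < k\<close> successes the count restarts, after \<open>i \<ge> k\<close> successes one run is counted and the count
  restarts \<open>g - 1\<close> trials later. With Pascal's rule and \<open>y = (p z)\<^sup>k\<close>,
  \<open>W = 1 - z + q z y (1 - z\<^bsup>g-1\<^esup>)\<close> this gives \<open>W B\<^sub>r = q z\<^sup>g y B\<^bsub>r-1\<^esub>\<close> for \<open>r \<ge> 2\<close> and
  \<open>W B\<^sub>1 = y (1 - p z) / (1 - z)\<close>. The coefficients of \<open>B\<^sub>r\<close> are then read off after expanding \<open>W\<^bsup>-r\<^esup>\<close>
  as a binomial series in \<open>q z y (1 - z\<^bsup>g-1\<^esup>) / (1 - z)\<close>.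
\<close>

section \<open>Recursion for the number of success runs\<close>

lemma first_run_beyond_cong:
  assumes "\<And>t. 1 \<le> t \<Longrightarrow> t \<le> n \<Longrightarrow> x t = y t"
  shows "first_run_beyond k n x = first_run_beyond k n y"
proof -
  have "run_beyond n x = run_beyond n y"
    using assms by (fastforce simp: run_beyond_def fun_eq_iff)
  then show ?thesis
    by (simp add: first_run_beyond_def maximal_run_beyond_def fun_eq_iff)
qed

lemma success_run_cong_imp:
  assumes "first_run_beyond k n x = first_run_beyond k n y" "success_run k g n x j a b"
  shows "success_run k g n y j a b"
  using assms(2)
proof induction
  case (first_run a b)
  then show ?case
    using assms(1) success_run.first_run by simp
next
  case (later_run j l m a b)
  then show ?case
    using assms(1) success_run.later_run[OF later_run.IH] by simp
qed

text \<open>Only trials in \<open>{1..n}\<close> are inspected. This permits replacing the outcome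
  function by list lookup, whose values beyond the end of the list are unspecified.\<close>

lemma num_success_runs_cong:
  assumes "\<And>t. 1 \<le> t \<Longrightarrow> t \<le> n \<Longrightarrow> x t = y t"
  shows "num_success_runs k g n x = num_success_runs k g n y"
proof -
  have "success_run k g n x = success_run k g n y"
    using success_run_cong_imp[of k n x y] success_run_cong_imp[of k n y x]
      first_run_beyond_cong[of n x y k, OF assms]
    by (auto intro!: ext)
  then show ?thesis
    by (simp only: num_success_runs_def)
qed

section \<open>Shifting the time origin\<close>

lemma run_beyond_shift:
  "run_beyond n x (c + d) a b \<longleftrightarrow>
     d \<le> a \<and> d \<le> b \<and> run_beyond (n - d) (\<lambda>t. x (t + d)) c (a - d) (b - d)"
proof (cases "d \<le> a \<and> a \<le> b")
  case True
  have "(\<forall>i\<in>{a..b}. x i) \<longleftrightarrow> (\<forall>i\<in>{a - d..b - d}. x (i + d))"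
    (is "?L \<longleftrightarrow> ?R")
  proof
    assume ?R
    show ?L
    proof
      fix i assume "i \<in> {a..b}"
      with True have "i - d \<in> {a - d..b - d}" "i - d + d = i" by auto
      with \<open>?R\<close> show "x i" by metis
    qed
  next
    assume ?L
    show ?R
    proof
      fix i assume "i \<in> {a - d..b - d}"
      with True have "i + d \<in> {a..b}" by auto
      with \<open>?L\<close> show "x (i + d)" by blast
    qed
  qed
  with True show ?thesis
    by (auto simp: run_beyond_def)
qed (auto simp: run_beyond_def)

lemma maximal_run_beyond_shift:
  "maximal_run_beyond n x (c + d) a b \<longleftrightarrow>
     d \<le> a \<and> d \<le> b \<and> maximal_run_beyond (n - d) (\<lambda>t. x (t + d)) c (a - d) (b - d)"
    (is "?L \<longleftrightarrow> ?R")
proof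
  assume L: ?L
  then have ab: "d \<le> a" "d \<le> b"
    by (auto simp: maximal_run_beyond_def run_beyond_shift)
  have "a' = a - d \<and> b' = b - d"
    if "run_beyond (n - d) (\<lambda>t. x (t + d)) c a' b'" "a' \<le> a - d" "b - d \<le> b'" for a' b'
  proof -
    \<comment> \<open>A competitor in the shifted trials is moved back by \<open>d\<close>, where
      the maximality of \<open>a\<close>, \<open>b\<close> applies to it.\<close>
    have "run_beyond n x (c + d) (a' + d) (b' + d)"
      using that by (simp add: run_beyond_shift)
    then have "a' + d = a \<and> b' + d = b"
      using L that ab unfolding maximal_run_beyond_def
      by (metis add_le_mono1 le_add_diff_inverse2 le_diff_conv)
    then show ?thesis by auto
  qed
  with L ab show ?R
    unfolding maximal_run_beyond_def run_beyond_shift by blast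
next
  assume R: ?R
  have "a' = a \<and> b' = b"
    if "run_beyond n x (c + d) a' b'" "a' \<le> a" "b \<le> b'" for a' b'
  proof -
    have "a' - d = a - d \<and> b' - d = b - d" "d \<le> a'" "d \<le> b'"
      using R that unfolding maximal_run_beyond_def run_beyond_shift
      by (metis diff_le_mono)+
    with R show ?thesis by auto
  qed
  with R show ?L
    unfolding maximal_run_beyond_def run_beyond_shift by blast
qed

lemma first_run_beyond_shift:
  "first_run_beyond k n x (c + d) a b \<longleftrightarrow>
     d \<le> a \<and> d \<le> b \<and> first_run_beyond k (n - d) (\<lambda>t. x (t + d)) c (a - d) (b - d)"
    (is "?L \<longleftrightarrow> ?R")
proof
  assume L: ?L
  have "a - d \<le> a'"
    if "maximal_run_beyond (n - d) (\<lambda>t. x (t + d)) c a' b'" "k \<le> b' + 1 - a'" for a' b'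
  proof -
    have "maximal_run_beyond n x (c + d) (a' + d) (b' + d)"
      using that by (simp add: maximal_run_beyond_shift)
    moreover have "k \<le> b' + d + 1 - (a' + d)"
      using that by simp
    ultimately have "a \<le> a' + d"
      using L unfolding first_run_beyond_def by blast
    then show ?thesis by auto
  qed
  with L show ?R
    unfolding first_run_beyond_def maximal_run_beyond_shift by auto
next
  assume R: ?R
  have "a \<le> a'"
    if "maximal_run_beyond n x (c + d) a' b'" "k \<le> b' + 1 - a'" for a' b'
  proof -
    have m: "maximal_run_beyond (n - d) (\<lambda>t. x (t + d)) c (a' - d) (b' - d)" "d \<le> a'" "d \<le> b'"
      using that unfolding maximal_run_beyond_shift by auto
    moreover have "k \<le> b' - d + 1 - (a' - d)"
      using that m by simp
    ultimately have "a - d \<le> a' - d"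
      using R unfolding first_run_beyond_def by blast
    then show ?thesis using R m by linarith
  qed
  with R show ?L
    unfolding first_run_beyond_def maximal_run_beyond_shift by auto
qed

lemma first_run_beyond_iff_shift:
  "first_run_beyond k n x (c + d) (a + d) (b + d) \<longleftrightarrow>
     first_run_beyond k (n - d) (\<lambda>t. x (t + d)) c a b"
  by (simp add: first_run_beyond_shift)

lemma first_run_beyond_unique:
  assumes "first_run_beyond k n x c a b" "first_run_beyond k n x c a' b'"
  shows "a = a'" "b = b'"
proof -
  show eq: "a = a'"
    using assms unfolding first_run_beyond_def by (meson le_antisym)
  show "b = b'"
    using assms eq unfolding first_run_beyond_def maximal_run_beyond_def
    by (metis le_cases order_refl)
qed

text \<open>Only the rule for the first run refers to the origin; each later run depends solely on
  the end of its predecessor. So if the first \<open>d\<close> trials do not affect the first run,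
  deleting them merely translates all runs.\<close>

lemma success_run_shift_iff:
  assumes skip: "\<And>a b. first_run_beyond k n x 0 a b \<longleftrightarrow> first_run_beyond k n x d a b"
  shows "success_run k g n x j a b \<longleftrightarrow>
    d \<le> a \<and> d \<le> b \<and> success_run k g (n - d) (\<lambda>t. x (t + d)) j (a - d) (b - d)"
proof
  assume "success_run k g n x j a b"
  then show "d \<le> a \<and> d \<le> b \<and> success_run k g (n - d) (\<lambda>t. x (t + d)) j (a - d) (b - d)"
  proof induction
    case (first_run a b)
    then have "first_run_beyond k n x (0 + d) a b"
      using skip by simp
    then show ?case
      unfolding first_run_beyond_shift by (blast intro: success_run.first_run)
  next
    case (later_run j l m a b)
    \<comment> \<open>The induction hypothesis gives \<open>d \<le> m\<close>, so this origin is
      really \<open>m + g\<close>, written in the form that the shift lemma expects.\<close>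
    then have "first_run_beyond k n x (m - d + g + d) a b"
      by simp
    from this[THEN first_run_beyond_shift[THEN iffD1]] show ?case
      using later_run.IH by (blast intro: success_run.later_run)
  qed
next
  have "success_run k g n x j (a + d) (b + d)"
    if "success_run k g (n - d) (\<lambda>t. x (t + d)) j a b" for a b
    using that
  proof induction
    case (first_run a b)
    then have "first_run_beyond k n x (0 + d) (a + d) (b + d)"
      by (simp only: first_run_beyond_iff_shift)
    then show ?case
      using skip success_run.first_run by simp
  next
    case (later_run j l m a b)
    then have "first_run_beyond k n x (m + g + d) (a + d) (b + d)"
      by (simp only: first_run_beyond_iff_shift)
    then show ?case
      using later_run by (auto intro!: success_run.later_run[of _ _ _ _ _ "l + d" "m + d"] simp: ac_simps)
  qed
  from this[of "a - d" "b - d"]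
  show "d \<le> a \<and> d \<le> b \<and> success_run k g (n - d) (\<lambda>t. x (t + d)) j (a - d) (b - d)
    \<Longrightarrow> success_run k g n x j a b"
    by auto
qed

lemma num_success_runs_skip:
  assumes skip: "\<And>a b. first_run_beyond k n x 0 a b \<longleftrightarrow> first_run_beyond k n x d a b"
  shows "num_success_runs k g n x = num_success_runs k g (n - d) (\<lambda>t. x (t + d))"
proof -
  have "(\<exists>a b. success_run k g n x j a b) \<longleftrightarrow>
     (\<exists>a b. success_run k g (n - d) (\<lambda>t. x (t + d)) j a b)" for j
    unfolding success_run_shift_iff[OF skip]
    by (metis add_diff_cancel_right' le_add2)
  then show ?thesis
    by (simp add: num_success_runs_def)
qed

lemma success_run_pos: "success_run k g n x j a b \<Longrightarrow> 0 < j"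
  by (induction rule: success_run.induct) auto

text \<open>The origin for the second run is \<open>b + g\<close>, which is what the first run of
  the trials after \<open>b + g\<close> sees as origin 0. The process therefore restarts there, with
  all indices lowered by one.\<close>

lemma success_run_Suc_iff:
  assumes fr: "first_run_beyond k n x 0 a b"
  shows "(\<exists>a' b'. success_run k g n x (Suc j) a' b') \<longleftrightarrow>
    j = 0 \<or> (\<exists>a' b'. success_run k g (n - (b + g)) (\<lambda>t. x (t + (b + g))) j a' b')"
proof -
  let ?d = "b + g"
  \<comment> \<open>The first disjunct is the first run itself; the second describes every later
    run, relocated past the gap.\<close>
  have to: "i = 1 \<and> a' = a \<and> b' = b \<or>
     ?d \<le> a' \<and> ?d \<le> b' \<and> success_run k g (n - ?d) (\<lambda>t. x (t + ?d)) (i - 1) (a' - ?d) (b' - ?d)"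
    if "success_run k g n x i a' b'" for i a' b'
    using that
  proof induction
    case (first_run a b)
    then show ?case using first_run_beyond_unique[OF fr] by auto
  next
    case (later_run j l m a' b')
    show ?case
    proof (cases "j = 1 \<and> l = a \<and> m = b")
      case True
      then have "first_run_beyond k n x (0 + ?d) a' b'"
        using later_run by simp
      then show ?thesis
        unfolding first_run_beyond_shift using True success_run.first_run by fastforce
    next
      case False
      then have IH: "?d \<le> l \<and> ?d \<le> m \<and>
          success_run k g (n - ?d) (\<lambda>t. x (t + ?d)) (j - 1) (l - ?d) (m - ?d)"
        using later_run by auto
      then have "first_run_beyond k n x (m - ?d + g + ?d) a' b'"
        using later_run by simp
      moreover have "Suc (j - 1) = j"
        using later_run by (auto dest: success_run_pos)
      ultimately show ?thesis
        using IH success_run.later_run[of k g "n - ?d" "\<lambda>t. x (t + ?d)" "j - 1" "l - ?d" "m - ?d"]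
          first_run_beyond_shift[of k n x "m - ?d + g" ?d a' b']
        by auto
    qed
  qed
  have from_: "success_run k g n x (Suc i) (a' + ?d) (b' + ?d)"
    if "success_run k g (n - ?d) (\<lambda>t. x (t + ?d)) i a' b'" for i a' b'
    using that
  proof induction
    case (first_run a' b')
    then have "first_run_beyond k n x (0 + ?d) (a' + ?d) (b' + ?d)"
      by (simp only: first_run_beyond_iff_shift)
    then show ?case
      using success_run.later_run[OF success_run.first_run[OF fr]] by simp
  next
    case (later_run j l m a' b')
    then have "first_run_beyond k n x (m + g + ?d) (a' + ?d) (b' + ?d)"
      by (simp only: first_run_beyond_iff_shift)
    then show ?case
      using success_run.later_run[OF later_run.IH, of "a' + ?d" "b' + ?d"]
      by (simp add: ac_simps)
  qed
  show ?thesis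
  proof (cases "j = 0")
    case True
    then show ?thesis using success_run.first_run[OF fr] by auto
  next
    case False
    with to[of "Suc j"] from_[of j] show ?thesis
      by (metis diff_Suc_1 old.nat.inject One_nat_def)
  qed
qed

lemma num_success_runs_first:
  assumes fr: "first_run_beyond k n x 0 a b"
  shows "num_success_runs k g n x =
    Suc (num_success_runs k g (n - (b + g)) (\<lambda>t. x (t + (b + g))))"
proof -
  let ?S = "{j. \<exists>a b'. success_run k g (n - (b + g)) (\<lambda>t. x (t + (b + g))) j a b'}"
  \<comment> \<open>Indices start at 1, so 0 is not in \<open>?S\<close> and the inserted 1 is a new
    element; this yields the \<open>Suc\<close>.\<close>
  have "{j. \<exists>a b. success_run k g n x j a b} = insert 1 (Suc ` ?S)" (is "?L = ?R")
  proof (rule set_eqI)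
    fix j
    show "j \<in> ?L \<longleftrightarrow> j \<in> ?R"
    proof (cases j)
      case 0
      then show ?thesis by (auto dest: success_run_pos)
    next
      case (Suc i)
      then show ?thesis
        unfolding insert_iff inj_image_mem_iff[OF inj_Suc] mem_Collect_eq Suc
          success_run_Suc_iff[OF fr, of g i]
        by simp
    qed
  qed
  moreover have "finite ?S" "1 \<notin> Suc ` ?S"
    using finite_success_runs by (auto dest: success_run_pos)
  ultimately show ?thesis
    by (simp add: num_success_runs_def card_image)
qed

lemma num_success_runs_none:
  assumes "\<And>a b. \<not> first_run_beyond k n x 0 a b"
  shows "num_success_runs k g n x = 0"
proof -
  have False if "success_run k g n x j a b" for j a b
    using that by induction (use assms in auto)
  then have "{j. \<exists>a b. success_run k g n x j a b} = {}"
    by blast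
  then show ?thesis
    by (simp only: num_success_runs_def card.empty)
qed

text \<open>No run contains the failure at \<open>Suc i\<close>, so each run lies entirely before or
  after it. Those before have at most \<open>i < k\<close> trials and are too short to count, so
  starting the search after the failure finds the same first run.\<close>

lemma first_run_beyond_short_run:
  assumes fail: "\<not> x (Suc i)" and "i < k"
  shows "first_run_beyond k n x 0 a b \<longleftrightarrow> first_run_beyond k n x (Suc i) a b"
proof -
  have avoid: "b' \<le> i \<or> Suc i < a'" if "run_beyond n x c a' b'" for c a' b'
    using that fail by (force simp: run_beyond_def not_le)
  have weaken: "run_beyond n x 0 a' b'" if "run_beyond n x (Suc i) a' b'" for a' b'
    using that by (auto simp: run_beyond_def)
  have strengthen: "run_beyond n x (Suc i) a' b'" if "run_beyond n x 0 a' b'" "i < b'" for a' b'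
    using that avoid[OF that(1)] by (auto simp: run_beyond_def)
  have "maximal_run_beyond n x 0 a b \<and> k \<le> b + 1 - a \<longleftrightarrow>
      maximal_run_beyond n x (Suc i) a b \<and> k \<le> b + 1 - a" for a b
  proof
    assume L: "maximal_run_beyond n x 0 a b \<and> k \<le> b + 1 - a"
    then have "run_beyond n x 0 a b"
      by (simp add: maximal_run_beyond_def)
    \<comment> \<open>A run of length at least \<open>k\<close> that starts at trial 1 or later ends
      at trial \<open>k\<close> or later.\<close>
    moreover from this have "i < b"
      using L \<open>i < k\<close> by (auto simp: run_beyond_def)
    ultimately have "run_beyond n x (Suc i) a b"
      by (rule strengthen)
    with L weaken show "maximal_run_beyond n x (Suc i) a b \<and> k \<le> b + 1 - a"
      unfolding maximal_run_beyond_def by blast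
  next
    assume R: "maximal_run_beyond n x (Suc i) a b \<and> k \<le> b + 1 - a"
    then have run: "run_beyond n x (Suc i) a b"
      by (simp add: maximal_run_beyond_def)
    then have "i < b"
      by (auto simp: run_beyond_def)
    then have "a' = a \<and> b' = b" if "run_beyond n x 0 a' b'" "a' \<le> a" "b \<le> b'" for a' b'
      using R strengthen[of a' b'] that unfolding maximal_run_beyond_def by auto
    with R weaken[OF run] show "maximal_run_beyond n x 0 a b \<and> k \<le> b + 1 - a"
      unfolding maximal_run_beyond_def by blast
  qed
  then show ?thesis
    unfolding first_run_beyond_def by (metis (no_types, lifting))
qed

text \<open>The two ways in which a run can end, at the last trial or before a failure, are treated
  together, so the result serves both the block before the first failure and the word without
  failures.\<close>

lemma first_run_beyond_long_run:
  assumes "\<And>t. 1 \<le> t \<Longrightarrow> t \<le> i \<Longrightarrow> x t" and "i \<le> n" "i = n \<or> \<not> x (Suc i)"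
    and "1 \<le> k" "k \<le> i"
  shows "first_run_beyond k n x 0 1 i"
proof -
  have "a' = 1 \<and> b' = i" if "run_beyond n x 0 a' b'" "a' \<le> 1" "i \<le> b'" for a' b'
  proof -
    have "\<not> i < b'"
      using that assms by (auto simp: run_beyond_def)
    with that show ?thesis by (auto simp: run_beyond_def)
  qed
  moreover have "run_beyond n x 0 1 i"
    using assms by (auto simp: run_beyond_def)
  ultimately show ?thesis
    using assms
    by (auto simp: first_run_beyond_def maximal_run_beyond_def)
      (auto simp: run_beyond_def)
qed

section \<open>Success runs of a finite outcome list\<close>

definition success_runs_list :: "nat \<Rightarrow> nat \<Rightarrow> bool list \<Rightarrow> nat" where
  "success_runs_list k g xs = num_success_runs k g (length xs) (\<lambda>t. xs ! (t - 1))"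

lemma success_runs_list_drop:
  "num_success_runs k g (length xs - d) (\<lambda>t. xs ! (t + d - 1)) = success_runs_list k g (drop d xs)"
  unfolding success_runs_list_def length_drop
  by (rule num_success_runs_cong) (simp add: add.commute)

lemma success_runs_list_short:
  assumes "i < k"
  shows "success_runs_list k g (replicate i True @ False # ys) = success_runs_list k g ys"
proof -
  let ?xs = "replicate i True @ False # ys"
  have "success_runs_list k g ?xs = success_runs_list k g (drop (Suc i) ?xs)"
    unfolding success_runs_list_drop[symmetric] unfolding success_runs_list_def
    by (rule num_success_runs_skip, rule first_run_beyond_short_run)
      (use assms in \<open>auto simp: nth_append\<close>)
  then show ?thesis by simp
qed

text \<open>The gap consists of the displayed failure and the next \<open>g - 1\<close> outcomes, so
  only the latter are dropped from \<open>ys\<close>. If \<open>ys\<close> is shorter than that,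
  nothing remains to be counted.\<close>

lemma success_runs_list_long:
  assumes "1 \<le> k" "k \<le> i" "1 \<le> g"
  shows "success_runs_list k g (replicate i True @ False # ys) =
    Suc (success_runs_list k g (drop (g - 1) ys))"
proof -
  let ?xs = "replicate i True @ False # ys"
  have "first_run_beyond k (length ?xs) (\<lambda>t. ?xs ! (t - 1)) 0 1 i"
    by (rule first_run_beyond_long_run) (use assms in \<open>auto simp: nth_append\<close>)
  from num_success_runs_first[OF this, of g]
  have "success_runs_list k g ?xs = Suc (success_runs_list k g (drop (i + g) ?xs))"
    unfolding success_runs_list_drop[symmetric] unfolding success_runs_list_def .
  moreover have "drop (i + g) ?xs = drop (g - 1) ys"
    using \<open>1 \<le> g\<close> by (cases g) auto
  ultimately show ?thesis by simp
qed

lemma success_runs_list_all_success: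
  assumes "1 \<le> k"
  shows "success_runs_list k g (replicate i True) = (if k \<le> i then 1 else 0)"
proof (cases "k \<le> i")
  case True
  let ?xs = "replicate i True"
  have "first_run_beyond k (length ?xs) (\<lambda>t. ?xs ! (t - 1)) 0 1 i"
    by (rule first_run_beyond_long_run) (use assms True in auto)
  from num_success_runs_first[OF this, of g]
  have "success_runs_list k g ?xs = Suc (success_runs_list k g (drop (i + g) ?xs))"
    unfolding success_runs_list_drop[symmetric] unfolding success_runs_list_def .
  moreover have "success_runs_list k g [] = 0"
    unfolding success_runs_list_def
    by (rule num_success_runs_none)
      (auto simp: first_run_beyond_def maximal_run_beyond_def run_beyond_def)
  ultimately show ?thesis using True by simp
next
  case False
  have "success_runs_list k g (replicate i True) = 0"
    unfolding success_runs_list_def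
    by (rule num_success_runs_none)
      (use False in \<open>auto simp: first_run_beyond_def maximal_run_beyond_def run_beyond_def\<close>)
  with False show ?thesis by simp
qed

section \<open>Expectations over independent trials\<close>

text \<open>Expectation over independent trials, built by conditioning on the first outcome, so that
  the recursions below are plain inductions free of measure theory.\<close>

primrec bernoulli_mean :: "real \<Rightarrow> nat \<Rightarrow> (bool list \<Rightarrow> real) \<Rightarrow> real" where
  "bernoulli_mean p 0 f = f []"
| "bernoulli_mean p (Suc n) f =
     p * bernoulli_mean p n (\<lambda>xs. f (True # xs)) + (1 - p) * bernoulli_mean p n (\<lambda>xs. f (False # xs))"

lemma bernoulli_mean_const [simp]: "bernoulli_mean p n (\<lambda>_. c) = c"
  by (induction n) (auto simp: algebra_simps)

lemma bernoulli_mean_add: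
  "bernoulli_mean p n (\<lambda>xs. f xs + h xs) = bernoulli_mean p n f + bernoulli_mean p n h"
  by (induction n arbitrary: f h) (auto simp: algebra_simps)

text \<open>Ignored trials integrate out because the weights \<open>p\<close> and
  \<open>1 - p\<close> add up to 1. For \<open>d > n\<close> both sides are the value at the empty
  list.\<close>

lemma bernoulli_mean_drop:
  "bernoulli_mean p n (\<lambda>xs. f (drop d xs)) = bernoulli_mean p (n - d) f"
proof (induction n arbitrary: d)
  case (Suc n)
  show ?case
  proof (cases d)
    case (Suc d')
    then show ?thesis
      using Suc.IH[of d'] by (simp add: algebra_simps)
  qed simp
qed simp

text \<open>Here \<open>i\<close> is the number of successes before the first failure; the last term
  is the outcome without any failure.\<close>

lemma bernoulli_mean_first_failure:
  "bernoulli_mean p n f =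
    (\<Sum>i<n. p ^ i * (1 - p) * bernoulli_mean p (n - 1 - i) (\<lambda>ys. f (replicate i True @ False # ys)))
    + p ^ n * f (replicate n True)"
proof (induction n arbitrary: f)
  case (Suc n)
  show ?case
    unfolding bernoulli_mean.simps Suc.IH[of "\<lambda>xs. f (True # xs)"] sum.lessThan_Suc_shift
    by (simp add: sum_distrib_left algebra_simps)
qed simp

lemma bernoulli_mean_eq_sum:
  "bernoulli_mean p n f =
    (\<Sum>xs | length xs = n. (\<Prod>i<n. if xs ! i then p else 1 - p) * f xs)"
proof (induction n arbitrary: f)
  case (Suc n)
  have fin: "finite {xs :: bool list. length xs = n}"
    using finite_lists_length_eq[of "UNIV :: bool set" n] by simp
  have split: "{xs. length xs = Suc n} =
      (Cons True ` {xs. length xs = n}) \<union> (Cons False ` {xs. length xs = n})"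
    by (auto simp: length_Suc_conv image_iff)
  show ?case
    unfolding split
    by (subst sum.union_disjoint)
      (auto simp: fin sum.reindex prod.lessThan_Suc_shift Suc.IH sum_distrib_left mult.assoc
        simp del: prod.lessThan_Suc)
qed simp

text \<open>Bridge from the probability space to the recursive mean: the space splits into the
  events of the individual outcome words, whose probabilities factor by independence.\<close>

lemma (in prob_space) expectation_indep_trials:
  assumes indep: "indep_vars (\<lambda>_. count_space UNIV) X {1..n}"
    and success: "\<And>i. i \<in> {1..n} \<Longrightarrow> prob {\<omega> \<in> space M. X i \<omega>} = p"
    and "1 \<le> n"
  shows "expectation (\<lambda>\<omega>. f (map (\<lambda>i. X i \<omega>) [1..<Suc n])) = bernoulli_mean p n f"
proof -
  \<comment> \<open>The event that the trials spell \<open>xs\<close>; trials are numbered from 1,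
    list entries from 0.\<close>
  define E where "E xs = (\<Inter>i\<in>{1..n}. X i -` {xs ! (i - 1)} \<inter> space M)" for xs :: "bool list"
  have rv: "X i \<in> measurable M (count_space UNIV)" if "i \<in> {1..n}" for i
    using indep that by (auto simp: indep_vars_def)
  have E_sets: "E xs \<in> events" for xs
    unfolding E_def using \<open>1 \<le> n\<close> by (intro sets.finite_INT measurable_sets[OF rv]) auto
  have fin: "finite {xs :: bool list. length xs = n}"
    using finite_lists_length_eq[of "UNIV :: bool set" n] by simp
  have outcome: "prob (X i -` {b} \<inter> space M) = (if b then p else 1 - p)" if "i \<in> {1..n}" for i b
  proof -
    have S: "X i -` {True} \<inter> space M = {\<omega> \<in> space M. X i \<omega>}" by auto
    have F: "X i -` {False} \<inter> space M = space M - (X i -` {True} \<inter> space M)" by auto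
    have "X i -` {True} \<inter> space M \<in> events"
      by (rule measurable_sets[OF rv[OF that]]) auto
    from prob_compl[OF this] show ?thesis
      using success[OF that] F S by (cases b) auto
  qed
  have prob_E: "prob (E xs) = (\<Prod>i<n. if xs ! i then p else 1 - p)" for xs
  proof -
    have "prob (E xs) = (\<Prod>i\<in>{1..n}. prob (X i -` {xs ! (i - 1)} \<inter> space M))"
      unfolding E_def by (rule indep_varsD_finite[OF indep]) (use \<open>1 \<le> n\<close> in auto)
    also have "\<dots> = (\<Prod>i\<in>{1..n}. if xs ! (i - 1) then p else 1 - p)"
      by (rule prod.cong) (auto simp: outcome)
    also have "\<dots> = (\<Prod>i<n. if xs ! i then p else 1 - p)"
      by (rule prod.reindex_bij_witness[of _ Suc "\<lambda>i. i - 1"]) auto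
    finally show ?thesis .
  qed
  have in_E: "\<omega> \<in> E xs \<longleftrightarrow> xs = map (\<lambda>i. X i \<omega>) [1..<Suc n]"
    if "\<omega> \<in> space M" "length xs = n" for \<omega> xs
  proof -
    have "xs = map (\<lambda>i. X i \<omega>) [1..<Suc n] \<longleftrightarrow> (\<forall>i<n. xs ! i = X (Suc i) \<omega>)"
      using that(2) by (auto simp: list_eq_iff_nth_eq simp del: upt_Suc)
    also have "\<dots> \<longleftrightarrow> (\<forall>i\<in>{1..n}. X i \<omega> = xs ! (i - 1))"
      by (auto simp: Ball_def)
    also have "\<dots> \<longleftrightarrow> \<omega> \<in> E xs"
      using that(1) by (auto simp: E_def)
    finally show ?thesis by simp
  qed
  have "expectation (\<lambda>\<omega>. f (map (\<lambda>i. X i \<omega>) [1..<Suc n])) =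
      expectation (\<lambda>\<omega>. \<Sum>xs | length xs = n. f xs * indicator (E xs) \<omega>)"
  proof (rule Bochner_Integration.integral_cong[OF refl])
    fix \<omega> assume \<omega>: "\<omega> \<in> space M"
    have "(\<Sum>xs | length xs = n. f xs * indicator (E xs) \<omega>) =
        (\<Sum>xs | length xs = n. if xs = map (\<lambda>i. X i \<omega>) [1..<Suc n] then f xs else 0)"
      by (rule sum.cong) (use in_E[OF \<omega>] in \<open>auto simp: indicator_def simp del: upt_Suc\<close>)
    also have "\<dots> = f (map (\<lambda>i. X i \<omega>) [1..<Suc n])"
      using fin by (simp add: sum.delta del: upt_Suc)
    finally show "f (map (\<lambda>i. X i \<omega>) [1..<Suc n]) =
        (\<Sum>xs | length xs = n. f xs * indicator (E xs) \<omega>)" by simp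
  qed
  also have "\<dots> = (\<Sum>xs | length xs = n. f xs * prob (E xs))"
    using E_sets by (subst Bochner_Integration.integral_sum)
      (auto intro!: integrable_mult_right integrable_real_indicator simp: emeasure_eq_measure)
  also have "\<dots> = bernoulli_mean p n f"
    by (simp add: bernoulli_mean_eq_sum prob_E mult.commute)
  finally show ?thesis .
qed

section \<open>Binomial moments of the number of success runs\<close>

definition binomial_moment :: "nat \<Rightarrow> nat \<Rightarrow> real \<Rightarrow> nat \<Rightarrow> nat \<Rightarrow> real" where
  "binomial_moment k g p r n =
     bernoulli_mean p n (\<lambda>xs. real (success_runs_list k g xs choose r))"

text \<open>Conditioning on the first failure: a block of at least \<open>k\<close> successes raises
  the count by one, and Pascal's rule splits the moment into orders \<open>Suc r\<close> and
  \<open>r\<close>. The word without failures has at most one run and so contributes only for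
  \<open>r = 0\<close>.\<close>

lemma binomial_moment_rec:
  assumes "1 \<le> k" "1 \<le> g"
  shows "binomial_moment k g p (Suc r) n =
    (\<Sum>i<n. p ^ i * (1 - p) *
      (if i < k then binomial_moment k g p (Suc r) (n - 1 - i)
       else binomial_moment k g p (Suc r) (n - 1 - i - (g - 1))
          + binomial_moment k g p r (n - 1 - i - (g - 1))))
    + (if k \<le> n \<and> r = 0 then p ^ n else 0)"
proof -
  let ?N = "success_runs_list k g"
  have short: "bernoulli_mean p m (\<lambda>ys. real (?N (replicate i True @ False # ys) choose Suc r))
      = binomial_moment k g p (Suc r) m" if "i < k" for i m
    using that by (simp add: success_runs_list_short binomial_moment_def)
  have long: "bernoulli_mean p m (\<lambda>ys. real (?N (replicate i True @ False # ys) choose Suc r))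
      = binomial_moment k g p (Suc r) (m - (g - 1)) + binomial_moment k g p r (m - (g - 1))"
    if "\<not> i < k" for i m
  proof -
    have "bernoulli_mean p m (\<lambda>ys. real (?N (replicate i True @ False # ys) choose Suc r))
        = bernoulli_mean p m (\<lambda>ys. (\<lambda>xs. real (?N xs choose Suc r) + real (?N xs choose r)) (drop (g - 1) ys))"
      using that assms by (simp add: success_runs_list_long add.commute)
    also have "\<dots> = bernoulli_mean p (m - (g - 1)) (\<lambda>xs. real (?N xs choose Suc r) + real (?N xs choose r))"
      by (rule bernoulli_mean_drop)
    finally show ?thesis
      by (simp add: bernoulli_mean_add binomial_moment_def)
  qed
  have "binomial_moment k g p (Suc r) n =
    (\<Sum>i<n. p ^ i * (1 - p) *
      bernoulli_mean p (n - 1 - i) (\<lambda>ys. real (?N (replicate i True @ False # ys) choose Suc r)))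
    + p ^ n * real (?N (replicate n True) choose Suc r)"
    unfolding binomial_moment_def by (rule bernoulli_mean_first_failure)
  moreover have "p ^ n * real (?N (replicate n True) choose Suc r) =
      (if k \<le> n \<and> r = 0 then p ^ n else 0)"
    using assms by (cases r) (auto simp: success_runs_list_all_success)
  moreover have "(\<Sum>i<n. p ^ i * (1 - p) *
      bernoulli_mean p (n - 1 - i) (\<lambda>ys. real (?N (replicate i True @ False # ys) choose Suc r)))
    = (\<Sum>i<n. p ^ i * (1 - p) *
      (if i < k then binomial_moment k g p (Suc r) (n - 1 - i)
       else binomial_moment k g p (Suc r) (n - 1 - i - (g - 1))
          + binomial_moment k g p r (n - 1 - i - (g - 1))))"
  proof (rule sum.cong[OF refl])
    fix i
    show "p ^ i * (1 - p) *
        bernoulli_mean p (n - 1 - i) (\<lambda>ys. real (?N (replicate i True @ False # ys) choose Suc r))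
      = p ^ i * (1 - p) *
        (if i < k then binomial_moment k g p (Suc r) (n - 1 - i)
         else binomial_moment k g p (Suc r) (n - 1 - i - (g - 1))
            + binomial_moment k g p r (n - 1 - i - (g - 1)))"
      using short[of i "n - 1 - i"] long[of i "n - 1 - i"] by (cases "i < k") simp_all
  qed
  ultimately show ?thesis
    by simp
qed

lemma binomial_moment_zero: "binomial_moment k g p 0 n = 1"
  by (simp add: binomial_moment_def)

lemma binomial_moment_no_trials:
  assumes "1 \<le> k"
  shows "binomial_moment k g p (Suc r) 0 = 0"
  using success_runs_list_all_success[OF assms, of g 0] assms by (simp add: binomial_moment_def)

section \<open>Generating functions of the binomial moments\<close>

unbundle no vec_syntax
unbundle fps_syntax

text \<open>Multiplication by the linear factor telescopes; only the first term of the tail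
  survives.\<close>

lemma fps_eq_shifted_geometric:
  fixes c :: "'a::comm_ring_1"
  shows "(1 - fps_const c * fps_X) * Abs_fps (\<lambda>i. if k \<le> i then c ^ i else 0)
    = fps_const (c ^ k) * fps_X ^ k"
proof (rule fps_ext)
  fix n
  show "((1 - fps_const c * fps_X) * Abs_fps (\<lambda>i. if k \<le> i then c ^ i else 0)) $ n
      = (fps_const (c ^ k) * fps_X ^ k) $ n"
    by (cases n) (auto simp: algebra_simps mult.assoc fps_X_power_nth le_Suc_eq)
qed

lemma fps_eq_truncated_geometric:
  fixes c :: "'a::comm_ring_1"
  shows "(1 - fps_const c * fps_X) * Abs_fps (\<lambda>i. if i < k then c ^ i else 0)
    = 1 - fps_const (c ^ k) * fps_X ^ k"
proof -
  \<comment> \<open>The vacuous test \<open>0 \<le> i\<close> presents the full geometric series as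
    the tail from 0, so that the previous lemma applies to both terms.\<close>
  have "Abs_fps (\<lambda>i. if i < k then c ^ i else 0) =
      Abs_fps (\<lambda>i. if 0 \<le> i then c ^ i else 0) - Abs_fps (\<lambda>i. if k \<le> i then c ^ i else 0)"
    by (auto simp: fps_eq_iff)
  then show ?thesis
    by (simp add: right_diff_distrib fps_eq_shifted_geometric del: le0)
       (use fps_eq_shifted_geometric[of c 0] in simp)
qed

text \<open>The probability that the first \<open>k\<close> trials all succeed, split by the
  position of the first failure.\<close>

lemma geometric_tail_sum:
  fixes p :: real
  shows "(\<Sum>i<n. if k \<le> i then p ^ i * (1 - p) else 0) + (if k \<le> n then p ^ n else 0)
    = (if k \<le> n then p ^ k else 0)"
  by (induction n) (auto simp: algebra_simps le_Suc_eq)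

context
  fixes k g :: nat and p :: real
begin

unbundle no vec_syntax
unbundle fps_syntax

definition moment_fps :: "nat \<Rightarrow> real fps" where
  "moment_fps r = Abs_fps (binomial_moment k g p r)"

definition run_fps :: "real fps" where
  "run_fps = fps_const (p ^ k) * fps_X ^ k"

text \<open>The series \<open>W\<close> of the opening comment, with \<open>run_fps\<close> as its
  \<open>y\<close>.\<close>

definition kernel_fps :: "real fps" where
  "kernel_fps = 1 - fps_X + fps_const (1 - p) * fps_X * run_fps * (1 - fps_X ^ (g - 1))"

definition first_block_short :: "real fps" where
  "first_block_short = Abs_fps (\<lambda>i. if i < k then p ^ i else 0)"

definition first_block_long :: "real fps" where
  "first_block_long = Abs_fps (\<lambda>i. if k \<le> i then p ^ i else 0)"

text \<open>For \<open>r = 0\<close> the constant moments of order 0 and the term for the word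
  without failures combine, by \<open>geometric_tail_sum\<close>, to the separate summand
  \<open>y / (1 - z)\<close>.\<close>

lemma moment_fps_rec:
  assumes k: "1 \<le> k" and g: "1 \<le> g"
  shows "moment_fps (Suc r) = fps_const (1 - p) * fps_X *
      (first_block_short * moment_fps (Suc r) + first_block_long *
        (fps_X ^ (g - 1) * (moment_fps (Suc r) + (if r = 0 then 0 else moment_fps r))))
    + (if r = 0 then run_fps * inverse (1 - fps_X) else 0)"
proof (rule fps_ext)
  fix n
  let ?B = "binomial_moment k g p"
  have geo: "inverse (1 - fps_X :: real fps) = Abs_fps (\<lambda>_. 1)"
    using fps_inverse_gp' by (metis fps_inverse_idempotent fps_nth_Abs_fps zero_neq_one)
  have tail: "(run_fps * inverse (1 - fps_X)) $ n = (if k \<le> n then p ^ k else 0)" for n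
    unfolding geo run_fps_def by (simp add: mult.assoc fps_X_power_mult_nth)
  \<comment> \<open>For \<open>j < g - 1\<close> the truncated index is 0, where moments of positive
    order vanish, in agreement with the series. The moment of order 0 is 1 there, which is why that
    order is kept apart.\<close>
  have shift: "(fps_X ^ (g - 1) * moment_fps (Suc r)) $ j = ?B (Suc r) (j - (g - 1))" for r j
    using binomial_moment_no_trials[OF k, of g p r]
    by (auto simp: fps_X_power_mult_nth moment_fps_def)
  show "moment_fps (Suc r) $ n = (fps_const (1 - p) * fps_X *
      (first_block_short * moment_fps (Suc r) + first_block_long *
        (fps_X ^ (g - 1) * (moment_fps (Suc r) + (if r = 0 then 0 else moment_fps r))))
    + (if r = 0 then run_fps * inverse (1 - fps_X) else 0)) $ n" (is "_ = ?R $ n")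
  proof (cases n)
    case 0
    then show ?thesis
      using binomial_moment_no_trials[OF k, of g p r] k
      by (simp add: moment_fps_def run_fps_def mult.assoc)
  next
    case (Suc m)
    have s: "(\<Sum>i<n. if i < k then p ^ i * (1 - p) * ?B (Suc r) (n - 1 - i) else 0)
        = (1 - p) * (first_block_short * moment_fps (Suc r)) $ m"
      unfolding Suc lessThan_Suc_atMost atMost_atLeast0 fps_mult_nth sum_distrib_left
      by (rule sum.cong) (auto simp: first_block_short_def moment_fps_def)
    have l: "(\<Sum>i<n. if k \<le> i then p ^ i * (1 - p) * ?B (Suc r') (n - 1 - i - (g - 1)) else 0)
        = (1 - p) * (first_block_long * (fps_X ^ (g - 1) * moment_fps (Suc r'))) $ m" for r'
      unfolding Suc lessThan_Suc_atMost atMost_atLeast0 fps_mult_nth[of first_block_long] shift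
        sum_distrib_left
      by (rule sum.cong) (auto simp: first_block_long_def)
    have "?B (Suc r) n =
        (\<Sum>i<n. if i < k then p ^ i * (1 - p) * ?B (Suc r) (n - 1 - i) else 0)
      + (\<Sum>i<n. if k \<le> i then p ^ i * (1 - p) * ?B (Suc r) (n - 1 - i - (g - 1)) else 0)
      + (\<Sum>i<n. if k \<le> i then p ^ i * (1 - p) * ?B r (n - 1 - i - (g - 1)) else 0)
      + (if k \<le> n \<and> r = 0 then p ^ n else 0)"
      unfolding binomial_moment_rec[OF k g, of p r n] sum.distrib[symmetric]
      by (intro arg_cong2[of _ _ _ _ "(+)"] refl sum.cong) (auto simp: algebra_simps)
    also have "\<dots> = ?R $ n"
    proof (cases r)
      case 0
      show ?thesis
        unfolding s l unfolding 0 binomial_moment_zero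
        using geometric_tail_sum[of k p n] tail[of n] Suc
        by (simp add: mult.assoc fps_X_mult_nth distrib_left del: sum.lessThan_Suc)
    next
      case (Suc r')
      show ?thesis
        unfolding s unfolding Suc l using \<open>n = Suc m\<close>
        by (simp add: mult.assoc fps_X_mult_nth distrib_left)
    qed
    finally show ?thesis
      by (simp add: moment_fps_def)
  qed
qed

text \<open>Multiplying the recursion by \<open>1 - p z\<close> turns both block series into
  polynomials, and the terms in \<open>moment_fps (Suc r)\<close> then collect to the
  kernel.\<close>

lemma kernel_mult_moment_fps:
  assumes k: "1 \<le> k" and g: "1 \<le> g"
  shows "kernel_fps * moment_fps (Suc r) =
     (if r = 0 then run_fps * (1 - fps_const p * fps_X) * inverse (1 - fps_X)
      else fps_const (1 - p) * run_fps * fps_X ^ g * moment_fps r)"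
proof -
  let ?q = "fps_const (1 - p)" and ?P = "1 - fps_const p * fps_X" and ?B = "moment_fps (Suc r)"
  let ?C = "if r = 0 then 0 else moment_fps r"
  let ?D = "if r = 0 then run_fps * inverse (1 - fps_X) else 0"
  have short: "?P * first_block_short = 1 - run_fps"
    unfolding first_block_short_def run_fps_def by (rule fps_eq_truncated_geometric)
  have long: "?P * first_block_long = run_fps"
    unfolding first_block_long_def run_fps_def by (rule fps_eq_shifted_geometric)
  have X: "fps_X * fps_X ^ (g - 1) = (fps_X ^ g :: real fps)"
    using g by (cases g) auto
  have q: "?q = 1 - fps_const p"
    by (simp add: fps_const_sub[symmetric] del: fps_const_sub)
  \<comment> \<open>A polynomial identity resting on \<open>c * x + (1 - c) * x = x\<close>, stated
    for variables to hide the structure of the series.\<close>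
  have collect: "(1 - x + (1 - c) * x * y * (1 - z)) * B = (1 - c) * y * (x * z) * C + (1 - c * x) * D"
    if "(1 - c * x) * B = (1 - c) * x * ((1 - y) * B + y * (z * (B + C))) + (1 - c * x) * D"
    for c x y z B C D :: "real fps"
    using that by algebra
  have "?P * ?B = ?q * fps_X * (?P * first_block_short * ?B + ?P * first_block_long *
      (fps_X ^ (g - 1) * (?B + ?C))) + ?P * ?D"
    by (subst moment_fps_rec[OF k g]) (simp only: algebra_simps)
  then have "?P * ?B = ?q * fps_X * ((1 - run_fps) * ?B + run_fps *
      (fps_X ^ (g - 1) * (?B + ?C))) + ?P * ?D"
    unfolding short long .
  then have "kernel_fps * ?B = ?q * run_fps * (fps_X * fps_X ^ (g - 1)) * ?C + ?P * ?D"
    unfolding kernel_fps_def q by (rule collect)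
  then show ?thesis
    unfolding X by (simp add: mult_ac)
qed

lemma kernel_power_mult_moment_fps:
  assumes "1 \<le> k" and "1 \<le> g"
  shows "kernel_fps ^ Suc r * moment_fps (Suc r) = (fps_const (1 - p) * run_fps * fps_X ^ g) ^ r *
     (run_fps * (1 - fps_const p * fps_X) * inverse (1 - fps_X))"
proof (induction r)
  case 0
  then show ?case by (simp add: kernel_mult_moment_fps[OF assms])
next
  case (Suc r)
  have "kernel_fps ^ Suc (Suc r) * moment_fps (Suc (Suc r)) =
      kernel_fps ^ Suc r * (kernel_fps * moment_fps (Suc (Suc r)))"
    by (simp add: mult_ac)
  also have "\<dots> = (fps_const (1 - p) * run_fps * fps_X ^ g) * (kernel_fps ^ Suc r * moment_fps (Suc r))"
    by (simp add: kernel_mult_moment_fps[OF assms] mult_ac)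
  finally show ?case
    unfolding Suc.IH by (simp add: mult_ac)
qed

end

section \<open>Coefficient extraction\<close>

lemma fps_mult_compose_nth:
  fixes F A c :: "'a::idom fps"
  assumes "c $ 0 = 0"
  shows "(F * (A oo c)) $ n = (\<Sum>l=0..n. A $ l * (F * c ^ l) $ n)"
proof -
  have "(A oo c) $ j = (\<Sum>l=0..n. A $ l * c ^ l $ j)" if "j \<le> n" for j
    unfolding fps_compose_nth
    \<comment> \<open>\<open>c ^ l\<close> has no terms below degree \<open>l\<close>, so the upper
      limit can be raised from \<open>j\<close> to \<open>n\<close>, uniformly in
      \<open>j\<close>.\<close>
    by (rule sum.mono_neutral_left) (use that startsby_zero_power_prefix[OF assms] in auto)
  then have "(F * (A oo c)) $ n = (\<Sum>i=0..n. F $ i * (\<Sum>l=0..n. A $ l * c ^ l $ (n - i)))"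
    unfolding fps_mult_nth by (intro sum.cong) auto
  also have "\<dots> = (\<Sum>l=0..n. \<Sum>i=0..n. A $ l * (F $ i * c ^ l $ (n - i)))"
    unfolding sum_distrib_left by (subst sum.swap) (simp add: mult_ac)
  finally show ?thesis
    by (simp add: fps_mult_nth sum_distrib_left)
qed

text \<open>Negative binomial series. For \<open>n < e\<close> the upper entry of
  \<open>binom\<close> falls below \<open>m\<close>, so the zero convention covers this case as
  well.\<close>

lemma fps_X_power_mult_neg_power_nth:
  "(fps_X ^ e * inverse (1 - fps_X :: real fps) ^ Suc m) $ n =
     real (binom (int n - int e + int m) m)"
proof -
  have "inverse (1 - fps_X :: real fps) ^ Suc m = Abs_fps (\<lambda>j. real ((m + j) choose m))"
    using one_minus_const_fps_X_neg_power'[of "Suc m" "1 :: real"]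
      binomial_symmetric[of m "m + j" for j]
    unfolding fps_inverse_power by simp
  then have "(fps_X ^ e * inverse (1 - fps_X :: real fps) ^ Suc m) $ n =
      (if n < e then 0 else real ((m + (n - e)) choose m))"
    by (simp add: fps_X_power_mult_nth del: power_Suc)
  also have "\<dots> = real (binom (int n - int e + int m) m)"
  proof (cases "e \<le> n")
    case True
    then obtain j where "n = e + j" by (auto simp: le_iff_add)
    then show ?thesis by (simp add: binom_def nat_add_distrib add.commute)
  qed (auto simp: binom_def)
  finally show ?thesis .
qed

text \<open>Each term of the expanded power of \<open>1 - fps_X ^ d\<close> is a monomial in front
  of a negative power; the factor \<open>1 - p z\<close> adds a copy with exponent one higher, hence
  the \<open>- 1\<close> in the second entry.\<close>

lemma coefficient_binomial_expansion:
  fixes p :: real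
  shows "(fps_X ^ e * (1 - fps_const p * fps_X) * (1 - fps_X ^ d) ^ l * inverse (1 - fps_X) ^ Suc m) $ n =
    (\<Sum>s=0..l. (-1) ^ s * real (l choose s) *
       (real (binom (int n - int e - int s * int d + int m) m)
        - p * real (binom (int n - int e - int s * int d - 1 + int m) m)))"
proof -
  let ?U = "inverse (1 - fps_X :: real fps) ^ Suc m"
  have "(1 - fps_X ^ d :: real fps) ^ l = (- (fps_X ^ d) + 1) ^ l"
    by simp
  also have "\<dots> = (\<Sum>s=0..l. fps_const ((-1) ^ s * real (l choose s)) * fps_X ^ (s * d))"
    unfolding binomial_ring atMost_atLeast0
  proof (rule sum.cong[OF refl])
    fix s
    have "(- (fps_X ^ d) :: real fps) ^ s = fps_const ((-1) ^ s) * fps_X ^ (s * d)"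
      unfolding power_minus[of "fps_X ^ d"] fps_const_power[symmetric]
      by (simp add: power_mult[symmetric] mult.commute fps_const_neg[symmetric] del: fps_const_neg)
    then show "of_nat (l choose s) * (- (fps_X ^ d)) ^ s * 1 ^ (l - s) =
        (fps_const ((-1) ^ s * real (l choose s)) * fps_X ^ (s * d) :: real fps)"
      by (simp add: fps_of_nat[symmetric] fps_const_mult[symmetric] mult_ac del: fps_const_mult)
  qed
  finally have expand: "(1 - fps_X ^ d :: real fps) ^ l =
      (\<Sum>s=0..l. fps_const ((-1) ^ s * real (l choose s)) * fps_X ^ (s * d))" .
  have "fps_X ^ e * (1 - fps_const p * fps_X) * (1 - fps_X ^ d) ^ l * ?U =
      (\<Sum>s=0..l. fps_const ((-1) ^ s * real (l choose s)) *
        (fps_X ^ (e + s * d) * ?U - fps_const p * (fps_X ^ Suc (e + s * d) * ?U)))"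
    unfolding expand sum_distrib_left sum_distrib_right
    by (rule sum.cong[OF refl]) (simp only: power_add power_Suc algebra_simps mult_1_left mult_1_right)
  then show ?thesis
    by (simp only: fps_sum_nth fps_mult_left_const_nth fps_sub_nth fps_X_power_mult_neg_power_nth)
       (simp add: algebra_simps)
qed

text \<open>The outer series is that of \<open>(1 + z)\<close> to the power \<open>- Suc r\<close>;
  composition with a series without constant term preserves the product.\<close>

lemma neg_power_compose:
  fixes c :: "real fps"
  assumes "c $ 0 = 0"
  shows "(Abs_fps (\<lambda>l. (-1) ^ l * real ((r + l) choose r)) oo c) * (1 + c) ^ Suc r = 1"
proof -
  let ?A = "Abs_fps (\<lambda>l. (-1) ^ l * real ((r + l) choose r))"
  have "inverse ((1 + fps_X :: real fps) ^ Suc r) = ?A"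
    using one_minus_const_fps_X_neg_power'[of "Suc r" "-1 :: real"]
      binomial_symmetric[of r "r + l" for l]
    by (simp add: mult.commute fps_const_neg[symmetric] del: power_Suc fps_const_neg)
  then have "?A * (1 + fps_X) ^ Suc r = 1"
    using inverse_mult_eq_1[of "(1 + fps_X :: real fps) ^ Suc r"] by (simp del: power_Suc)
  then have "(?A * (1 + fps_X) ^ Suc r) oo c = 1 oo c"
    by (rule arg_cong)
  then show ?thesis
    using assms
    by (simp add: fps_compose_mult_distrib fps_compose_power[symmetric] fps_compose_add_distrib
        del: power_Suc)
qed

lemma binomial_moment_eq_sum:
  assumes "1 \<le> k" "1 \<le> g"
  shows "binomial_moment k g p (Suc r) n =
    (\<Sum>l=0..n. (-1) ^ l * real ((r + l) choose r) * ((1 - p) ^ (r + l) * p ^ (k * Suc (r + l)) *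
       (\<Sum>s=0..l. (-1) ^ s * real (l choose s) *
         (real (binom (int n - int (g * r + l + k * Suc (r + l)) - int s * int (g - 1) + int (Suc (r + l))) (Suc (r + l)))
          - p * real (binom (int n - int (g * r + l + k * Suc (r + l)) - int s * int (g - 1) - 1 + int (Suc (r + l))) (Suc (r + l)))))))"
proof -
  let ?Y = "run_fps k p" and ?Q = "fps_const (1 - p)" and ?P = "1 - fps_const p * fps_X"
  let ?U = "inverse (1 - fps_X :: real fps)" and ?B = "moment_fps k g p (Suc r)"
  \<comment> \<open>Chosen so that the kernel equals \<open>(1 - fps_X) * (1 + c)\<close>.\<close>
  define c where "c = ?U * (?Q * fps_X * ?Y * (1 - fps_X ^ (g - 1)))"
  define A where "A = Abs_fps (\<lambda>l. (-1) ^ l * real ((r + l) choose r))"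
  \<comment> \<open>The right-hand side of \<open>kernel_power_mult_moment_fps\<close> divided by
    \<open>(1 - fps_X) ^ Suc r\<close>; what remains is the inverse power of \<open>1 + c\<close>,
    that is \<open>A oo c\<close>.\<close>
  define F where "F = (?Q * ?Y * fps_X ^ g) ^ r * (?Y * ?P * ?U) * ?U ^ Suc r"
  have U: "(1 - fps_X) * ?U = 1"
    using inverse_mult_eq_1[of "1 - fps_X :: real fps"] by (simp add: mult.commute)
  have c0: "c $ 0 = 0"
    by (simp add: c_def)
  have "kernel_fps k g p = (1 - fps_X) * (1 + c)"
    unfolding c_def kernel_fps_def distrib_left mult.assoc[symmetric] U by simp
  then have "((1 - fps_X) * (1 + c)) ^ Suc r * ?B = (?Q * ?Y * fps_X ^ g) ^ r * (?Y * ?P * ?U)"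
    using kernel_power_mult_moment_fps[OF assms, of p r] by simp
  then have "(1 - fps_X) ^ Suc r * (1 + c) ^ Suc r * ?B * (?U ^ Suc r * (A oo c)) = F * (A oo c)"
    unfolding F_def power_mult_distrib[of "1 - fps_X" "1 + c"] by (simp only: mult_ac)
  moreover have "(1 - fps_X) ^ Suc r * (1 + c) ^ Suc r * ?B * (?U ^ Suc r * (A oo c)) =
      ((1 - fps_X) * ?U) ^ Suc r * ((A oo c) * (1 + c) ^ Suc r) * ?B"
    unfolding power_mult_distrib by (simp only: mult_ac)
  moreover have "\<dots> = ?B"
    unfolding U A_def neg_power_compose[OF c0] by simp
  ultimately have B: "?B = F * (A oo c)"
    by metis
  have F: "(F * c ^ l) $ n = (1 - p) ^ (r + l) * p ^ (k * Suc (r + l)) *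
      (fps_X ^ (g * r + l + k * Suc (r + l)) * ?P * (1 - fps_X ^ (g - 1)) ^ l
        * ?U ^ Suc (Suc (r + l))) $ n" for l
  proof -
    have "F * c ^ l = ?Q ^ (r + l) * ?Y ^ Suc (r + l) * (fps_X ^ (g * r + l) * ?P *
        (1 - fps_X ^ (g - 1)) ^ l * ?U ^ Suc (Suc (r + l)))"
      unfolding F_def c_def power_mult_distrib power_add power_mult power_Suc by (simp only: mult_ac)
    also have "?Y ^ Suc (r + l) = fps_const (p ^ (k * Suc (r + l))) * fps_X ^ (k * Suc (r + l))"
      unfolding run_fps_def power_mult_distrib power_mult fps_const_power ..
    also have "?Q ^ (r + l) = fps_const ((1 - p) ^ (r + l))"
      by (rule fps_const_power)
    finally have "F * c ^ l = fps_const ((1 - p) ^ (r + l) * p ^ (k * Suc (r + l))) *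
       (fps_X ^ (g * r + l + k * Suc (r + l)) * ?P * (1 - fps_X ^ (g - 1)) ^ l
        * ?U ^ Suc (Suc (r + l)))"
      unfolding fps_const_mult[symmetric] power_add[of fps_X "g * r + l"] by (simp only: mult_ac)
    then show ?thesis by (simp only: fps_mult_left_const_nth)
  qed
  have "binomial_moment k g p (Suc r) n = (F * (A oo c)) $ n"
    unfolding B[symmetric] moment_fps_def by simp
  also have "\<dots> = (\<Sum>l=0..n. A $ l * (F * c ^ l) $ n)"
    by (rule fps_mult_compose_nth[OF c0])
  finally show ?thesis
    unfolding F coefficient_binomial_expansion by (simp only: A_def fps_nth_Abs_fps)
qed

lemma prod_diff_eq_fact_mult_choose:
  "(\<Prod>i<r. real N - real i) = fact r * real (N choose r)"
  unfolding binomial_gbinomial gbinomial_prod_rev by (simp add: atLeast0LessThan)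

section \<open>The closed formula for the factorial moments\<close>

theorem mainTheorem5:
  fixes M :: "'a measure" and X :: "nat \<Rightarrow> 'a \<Rightarrow> bool"
    and k g n r :: nat and p q :: real and \<nu> :: int
  assumes "prob_space M"
    and "prob_space.indep_vars M (\<lambda>_. count_space UNIV) X {1..n}"
    and "\<And>i. i \<in> {1..n} \<Longrightarrow> measure M {\<omega> \<in> space M. X i \<omega>} = p"
    and "k \<ge> 1" and "g \<ge> 1" and "n \<ge> 1" and "r \<ge> 1"
    and "0 < p" and "p < 1" and "q = 1 - p"
    and "\<nu> = int n - (int r - 1) * (int g - 1)"
  shows "prob_space.expectation M
           (\<lambda>\<omega>. \<Prod>i<r. real (num_success_runs k g n (\<lambda>t. X t \<omega>)) - real i)
         = fact r *
           (\<Sum>m = r..nat \<lfloor>(real_of_int \<nu> + 1) / (real k + 1)\<rfloor>.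
              (-1) ^ (m - r) * q ^ (m - 1) * p ^ (m * k) * real ((m - 1) choose (r - 1)) *
              (\<Sum>s = 0..m - r. (-1) ^ s * real ((m - r) choose s) *
                 (real (binom (\<nu> + 1 - int m * int k - int s * (int g - 1)) m)
                  - p * real (binom (\<nu> - int m * int k - int s * (int g - 1)) m))))"
    (is "_ = fact r * (\<Sum>m = r..?u. ?h m)")
proof -
  interpret prob_space M by fact
  obtain r' where r: "r = Suc r'" using \<open>r \<ge> 1\<close> by (cases r) auto
  obtain g' where g: "g = Suc g'" using \<open>g \<ge> 1\<close> by (cases g) auto
  have runs: "num_success_runs k g n (\<lambda>t. X t \<omega>) =
      success_runs_list k g (map (\<lambda>i. X i \<omega>) [1..<Suc n])" for \<omega>
    unfolding success_runs_list_def length_map length_upt diff_Suc_1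
  proof (rule num_success_runs_cong)
    fix t assume "1 \<le> t" "t \<le> n"
    then show "X t \<omega> = map (\<lambda>i. X i \<omega>) [1..<Suc n] ! (t - 1)"
      by (cases t) (simp_all del: upt_Suc)
  qed
  have "expectation (\<lambda>\<omega>. \<Prod>i<r. real (num_success_runs k g n (\<lambda>t. X t \<omega>)) - real i) =
      fact r * expectation (\<lambda>\<omega>. real (success_runs_list k g (map (\<lambda>i. X i \<omega>) [1..<Suc n]) choose r))"
    unfolding prod_diff_eq_fact_mult_choose runs by simp
  also have "expectation (\<lambda>\<omega>. real (success_runs_list k g (map (\<lambda>i. X i \<omega>) [1..<Suc n]) choose r)) =
      binomial_moment k g p r n"
    unfolding binomial_moment_def
    by (rule expectation_indep_trials[of X n p "\<lambda>xs. real (success_runs_list k g xs choose r)"])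
      (use assms in auto)
  also have "binomial_moment k g p r n = (\<Sum>l=0..n. ?h (l + r))"
    unfolding r binomial_moment_eq_sum[OF \<open>k \<ge> 1\<close> \<open>g \<ge> 1\<close>]
  proof (rule sum.cong[OF refl])
    fix l
    let ?m = "Suc (r' + l)"
    \<comment> \<open>With \<open>?m = r' + l + 1\<close> the \<open>l\<close> cancels, and
      \<open>n - g * r' + r'\<close> is \<open>\<nu>\<close>.\<close>
    have upper: "int n - int (g * r' + l + k * ?m) - int s * int (g - 1) + int ?m =
        \<nu> + 1 - int ?m * int k - int s * (int g - 1)"
      "int n - int (g * r' + l + k * ?m) - int s * int (g - 1) - 1 + int ?m =
        \<nu> - int ?m * int k - int s * (int g - 1)" for s
      unfolding assms(11) r g by (simp_all add: algebra_simps)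
    have m: "l + Suc r' = ?m" by simp
    show "(-1) ^ l * real ((r' + l) choose r') * ((1 - p) ^ (r' + l) * p ^ (k * ?m) *
       (\<Sum>s=0..l. (-1) ^ s * real (l choose s) *
         (real (binom (int n - int (g * r' + l + k * ?m) - int s * int (g - 1) + int ?m) ?m)
          - p * real (binom (int n - int (g * r' + l + k * ?m) - int s * int (g - 1) - 1 + int ?m) ?m))))
      = (-1) ^ (l + Suc r' - Suc r') * q ^ (l + Suc r' - 1) * p ^ ((l + Suc r') * k) *
          real ((l + Suc r' - 1) choose (Suc r' - 1)) *
         (\<Sum>s = 0..l + Suc r' - Suc r'. (-1) ^ s * real ((l + Suc r' - Suc r') choose s) *
           (real (binom (\<nu> + 1 - int (l + Suc r') * int k - int s * (int g - 1)) (l + Suc r'))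
            - p * real (binom (\<nu> - int (l + Suc r') * int k - int s * (int g - 1)) (l + Suc r'))))"
      unfolding upper m assms(10)[symmetric] add_diff_cancel_right' diff_Suc_1
      by (simp add: mult.commute[of k])
  qed
  also have "\<dots> = (\<Sum>m=r..n + r. ?h m)"
    using sum.shift_bounds_cl_nat_ivl[of ?h 0 r n] by simp
  also have "\<dots> = (\<Sum>m=r..?u. ?h m)"
  \<comment> \<open>The series argument sums up to \<open>n + r\<close>. The stated limit is no
    larger, and beyond it \<open>\<nu> + 1 - m * k < m\<close>, so all binomials vanish.\<close>
  proof (rule sum.mono_neutral_right)
    have "\<nu> \<le> int n"
      unfolding assms(11) r g by simp
    have "(real_of_int \<nu> + 1) / (real k + 1) \<le> real n"
    proof -
      \<comment> \<open>\<open>n + 1 \<le> 2 * n\<close> by \<open>n \<ge> 1\<close>; the factor 2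
        is then absorbed by \<open>k + 1\<close>.\<close>
      have "real_of_int (\<nu> + 1) \<le> real_of_int (int n * 2)"
        using \<open>\<nu> \<le> int n\<close> \<open>n \<ge> 1\<close> unfolding of_int_le_iff by linarith
      then have "real_of_int \<nu> + 1 \<le> real n * (1 + 1)"
        by simp
      also have "\<dots> \<le> real n * (real k + 1)"
        using \<open>k \<ge> 1\<close> by (intro mult_left_mono) auto
      finally show ?thesis by (simp add: divide_le_eq)
    qed
    then have "?u \<le> n" by linarith
    then show "{r..?u} \<subseteq> {r..n + r}" by auto
    show "\<forall>m\<in>{r..n + r} - {r..?u}. ?h m = 0"
    proof
      fix m assume "m \<in> {r..n + r} - {r..?u}"
      then have "\<lfloor>(real_of_int \<nu> + 1) / (real k + 1)\<rfloor> < int m" by auto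
      then have "(real_of_int \<nu> + 1) / (real k + 1) < real m" by linarith
      then have "real_of_int \<nu> + 1 < real m * (real k + 1)"
        by (simp add: divide_less_eq)
      also have "\<dots> = real_of_int (int m * int k + int m)"
        by (simp add: algebra_simps)
      finally have "\<nu> + 1 < int m * int k + int m" by linarith
      moreover have "0 \<le> int s * (int g - 1)" for s
        using \<open>g \<ge> 1\<close> by simp
      ultimately have "binom (\<nu> + 1 - int m * int k - int s * (int g - 1)) m = 0 \<and>
          binom (\<nu> - int m * int k - int s * (int g - 1)) m = 0" for s
        by (smt (verit) binom_def)
      then show "?h m = 0" by simp
    qed
  qed simp
  finally show ?thesis .
qed

end
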